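(* Let $H$ and $K$ be cancellative semigroups, at least one of which is commutative. Then the following conditions are equivalent: (a) $H$ and $K$ are globally isomorphic, i.e., $\mathcal P(H)$ is isomorphic to $\mathcal P(K)$; (b) $\mathcal P_{\mathrm{fin}}(H)$ is isomorphic to $\mathcal P_{\mathrm{fin}}(K)$; (c) $H$ is isomorphic to $K$. Here "isomorphic" always means isomorphic as semigroups.
   Context: All semigroups are written multiplicatively. For a semigroup $S$, $\mathcal P(S)$ (the large power semigroup of $S$) is the semigroup of all non-empty subsets of $S$ under setwise multiplication $XY := \{xy : x \in X,\ y \in Y\}$, and $\mathcal P_{\mathrm{fin}}(S)$ (the finitary power semigroup of $S$) is the subsemigroup of $\mathcal P(S)$ consisting of all non-empty finite subsets of $S$. A semigroup $S$ is cancellative if, for every $a \in S$, both maps $S \to S$, $x \mapsto ax$ and $x \mapsto xa$ are injective. *)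

theory Defs
  imports "HOL-Algebra.Coset"
begin

text \<open>
  Semigroups live on the record type of \<^locale>\<open>monoid\<close>, so that \<^const>\<open>hom\<close>, \<^const>\<open>iso\<close>,
  \<^const>\<open>is_iso\<close> and \<^const>\<open>set_mult\<close> apply to them. All of these depend only on the fields
  \<open>carrier\<close> and \<open>mult\<close>; the field \<open>one\<close> is never constrained and carries no meaning. In
  particular, \<open>H \<cong> K\<close> is isomorphism of semigroups, with no condition on identities. The carrier
  is allowed to be empty.
\<close>

locale mult_semigroup =
  fixes S (structure)
  assumes m_closed: "\<lbrakk>x \<in> carrier S; y \<in> carrier S\<rbrakk> \<Longrightarrow> x \<otimes> y \<in> carrier S"
    and m_assoc: "\<lbrakk>x \<in> carrier S; y \<in> carrier S; z \<in> carrier S\<rbrakk>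
      \<Longrightarrow> (x \<otimes> y) \<otimes> z = x \<otimes> (y \<otimes> z)"

locale cancellative_semigroup = mult_semigroup +
  assumes inj_on_left_mult: "a \<in> carrier S \<Longrightarrow> inj_on (\<lambda>x. a \<otimes> x) (carrier S)"
    and inj_on_right_mult: "a \<in> carrier S \<Longrightarrow> inj_on (\<lambda>x. x \<otimes> a) (carrier S)"

definition commutative :: "('a, 'm) monoid_scheme \<Rightarrow> bool" where
  "commutative S \<longleftrightarrow> (\<forall>x \<in> carrier S. \<forall>y \<in> carrier S. x \<otimes>\<^bsub>S\<^esub> y = y \<otimes>\<^bsub>S\<^esub> x)"

definition power_semigroup :: "('a, 'm) monoid_scheme \<Rightarrow> 'a set monoid" where
  "power_semigroup S =
    \<lparr>carrier = {X. X \<subseteq> carrier S \<and> X \<noteq> {}}, mult = set_mult S, one = {\<one>\<^bsub>S\<^esub>}\<rparr>"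

definition fin_power_semigroup :: "('a, 'm) monoid_scheme \<Rightarrow> 'a set monoid" where
  "fin_power_semigroup S =
    (power_semigroup S)\<lparr>carrier := {X \<in> carrier (power_semigroup S). finite X}\<rparr>"

lemma mult_power_semigroup:
  "X \<otimes>\<^bsub>power_semigroup S\<^esub> Y = {x \<otimes>\<^bsub>S\<^esub> y | x y. x \<in> X \<and> y \<in> Y}"
  by (auto simp: power_semigroup_def set_mult_def)

lemma (in mult_semigroup) mult_semigroup_power_semigroup:
  "mult_semigroup (power_semigroup S)"
proof
  fix X Y
  assume "X \<in> carrier (power_semigroup S)" "Y \<in> carrier (power_semigroup S)"
  then show "X \<otimes>\<^bsub>power_semigroup S\<^esub> Y \<in> carrier (power_semigroup S)"
    by (auto simp: power_semigroup_def set_mult_def intro!: m_closed)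
next
  fix X Y Z
  assume "X \<in> carrier (power_semigroup S)" "Y \<in> carrier (power_semigroup S)"
    "Z \<in> carrier (power_semigroup S)"
  then have sub: "X \<subseteq> carrier S" "Y \<subseteq> carrier S" "Z \<subseteq> carrier S"
    by (auto simp: power_semigroup_def)
  have "(\<Union>x\<in>X. \<Union>y\<in>Y. \<Union>z\<in>Z. {(x \<otimes> y) \<otimes> z}) = (\<Union>x\<in>X. \<Union>y\<in>Y. \<Union>z\<in>Z. {x \<otimes> (y \<otimes> z)})"
    using sub by (intro SUP_cong refl) (simp add: m_assoc subset_iff)
  then show "(X \<otimes>\<^bsub>power_semigroup S\<^esub> Y) \<otimes>\<^bsub>power_semigroup S\<^esub> Z =
      X \<otimes>\<^bsub>power_semigroup S\<^esub> (Y \<otimes>\<^bsub>power_semigroup S\<^esub> Z)"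
    by (simp add: power_semigroup_def set_mult_def)
qed

lemma (in mult_semigroup) mult_semigroup_fin_power_semigroup:
  "mult_semigroup (fin_power_semigroup S)"
proof -
  interpret P: mult_semigroup "power_semigroup S"
    by (rule mult_semigroup_power_semigroup)
  have fin: "finite (X \<otimes>\<^bsub>power_semigroup S\<^esub> Y)" if "finite X" "finite Y" for X Y
    using that by (simp add: power_semigroup_def set_mult_def)
  show ?thesis
    by unfold_locales
      (auto simp: fin_power_semigroup_def P.m_assoc intro: P.m_closed fin)
qed

end

theory Submission
  imports Defs
begin

text \<open>
  A semigroup \<open>S\<close> sits inside its power semigroups as the set of singletons, so an isomorphism of
  power semigroups yields one of the underlying semigroups as soon as it maps singletons to
  singletons. When \<open>S\<close> is commutative and cancellative, singletons have a description that every
  isomorphism respects: they are precisely the cancellable elements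
  (lemma \<open>left_cancellable_iff_singleton\<close>). The point is that a set \<open>X\<close> with two distinct
  elements \<open>a\<close> and \<open>b\<close> is never cancellable, because deleting the product \<open>ab\<close> from \<open>X\<^sup>2\<close> does not
  change the product with \<open>X\<close>.

  Commutativity of one of the two semigroups is enough, since a semigroup is commutative if and
  only if its power semigroup is, and commutativity passes along isomorphisms.

  Only two features of the power semigroups enter: they contain all singletons and all
  non-empty subsets of their members. The argument therefore covers the large and the finitary
  power semigroup simultaneously. In the opposite direction, an isomorphism \<open>f\<close> of semigroups acts
  on subsets by direct image, and direct images preserve finiteness.
\<close>

section \<open>Invariance under isomorphism\<close>

definition left_cancellable :: "('a, 'm) monoid_scheme \<Rightarrow> 'a \<Rightarrow> bool" where
  "left_cancellable G x \<longleftrightarrow> inj_on (\<lambda>y. x \<otimes>\<^bsub>G\<^esub> y) (carrier G)"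

lemma mult_in_set_mult: "x \<in> X \<Longrightarrow> y \<in> Y \<Longrightarrow> x \<otimes>\<^bsub>G\<^esub> y \<in> X <#>\<^bsub>G\<^esub> Y"
  by (auto simp: set_mult_def)

lemma iso_commutative_iff:
  assumes "mult_semigroup G" and h: "h \<in> iso G G'"
  shows "commutative G \<longleftrightarrow> commutative G'"
proof -
  interpret G: mult_semigroup G by fact
  have hom: "h (x \<otimes>\<^bsub>G\<^esub> y) = h x \<otimes>\<^bsub>G'\<^esub> h y" if "x \<in> carrier G" "y \<in> carrier G" for x y
    using h that by (simp add: iso_def hom_def)
  have inj: "inj_on h (carrier G)" and surj: "carrier G' = h ` carrier G"
    using h by (auto simp: iso_def bij_betw_def)
  have "x \<otimes>\<^bsub>G\<^esub> y = y \<otimes>\<^bsub>G\<^esub> x \<longleftrightarrow> h x \<otimes>\<^bsub>G'\<^esub> h y = h y \<otimes>\<^bsub>G'\<^esub> h x"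
    if "x \<in> carrier G" "y \<in> carrier G" for x y
    using that inj_on_eq_iff[OF inj G.m_closed G.m_closed, of x y y x] by (simp add: hom)
  then show ?thesis by (simp add: commutative_def surj)
qed

lemma iso_left_cancellable_iff:
  assumes "mult_semigroup G" and h: "h \<in> iso G G'" and x: "x \<in> carrier G"
  shows "left_cancellable G x \<longleftrightarrow> left_cancellable G' (h x)"
proof -
  interpret G: mult_semigroup G by fact
  have hom: "h (x \<otimes>\<^bsub>G\<^esub> y) = h x \<otimes>\<^bsub>G'\<^esub> h y" if "y \<in> carrier G" for y
    using h x that by (simp add: iso_def hom_def)
  have inj: "inj_on h (carrier G)" and surj: "carrier G' = h ` carrier G"
    using h by (auto simp: iso_def bij_betw_def)
  have "x \<otimes>\<^bsub>G\<^esub> y = x \<otimes>\<^bsub>G\<^esub> z \<longleftrightarrow> h x \<otimes>\<^bsub>G'\<^esub> h y = h x \<otimes>\<^bsub>G'\<^esub> h z"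
    if "y \<in> carrier G" "z \<in> carrier G" for y z
    using that x inj_on_eq_iff[OF inj G.m_closed G.m_closed, of x y x z] by (simp add: hom)
  moreover have "h y = h z \<longleftrightarrow> y = z" if "y \<in> carrier G" "z \<in> carrier G" for y z
    using inj_on_eq_iff[OF inj] that by blast
  ultimately show ?thesis by (simp add: left_cancellable_def inj_on_def surj)
qed

section \<open>Cancellable elements of downward complete power semigroups\<close>

text \<open>
  The subsemigroups of the large power semigroup that contain the singletons and are closed under
  passing to non-empty subsets: the common setting for the large and the finitary power semigroup.
\<close>

locale downward_complete_power = cancellative_semigroup S + P: mult_semigroup P
  for S :: "('a, 'm) monoid_scheme" (structure) and P :: "('a set, 'n) monoid_scheme" +
  assumes mult_P: "mult P = set_mult S"
    and carrier_P: "X \<in> carrier P \<Longrightarrow> X \<subseteq> carrier S \<and> X \<noteq> {}"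
    and singleton_P: "x \<in> carrier S \<Longrightarrow> {x} \<in> carrier P"
    and subset_P: "\<lbrakk>X \<in> carrier P; Y \<subseteq> X; Y \<noteq> {}\<rbrakk> \<Longrightarrow> Y \<in> carrier P"
begin

lemma commutative_P_iff: "commutative P \<longleftrightarrow> commutative S"
proof
  assume P: "commutative P"
  have "{x} <#> {y} = {y} <#> {x}" if "x \<in> carrier S" "y \<in> carrier S" for x y
    using P that singleton_P by (simp add: commutative_def mult_P)
  then show "commutative S"
    by (simp add: commutative_def set_mult_def)
next
  assume S: "commutative S"
  have "X <#> Y \<subseteq> Y <#> X" if "X \<in> carrier P" "Y \<in> carrier P" for X Y
  proof
    fix u assume "u \<in> X <#> Y"
    then obtain x y where "x \<in> X" "y \<in> Y" "u = x \<otimes> y" by (auto simp: set_mult_def)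
    moreover from this have "u = y \<otimes> x"
      using S carrier_P[OF that(1)] carrier_P[OF that(2)] by (auto simp: commutative_def)
    ultimately show "u \<in> Y <#> X" by (metis mult_in_set_mult)
  qed
  then show "commutative P" by (auto simp: commutative_def mult_P)
qed

lemma singleton_left_cancellable:
  assumes a: "a \<in> carrier S"
  shows "left_cancellable P {a}"
  unfolding left_cancellable_def
proof (rule inj_onI)
  fix Y Z
  assume YZ: "Y \<in> carrier P" "Z \<in> carrier P" and eq: "{a} \<otimes>\<^bsub>P\<^esub> Y = {a} \<otimes>\<^bsub>P\<^esub> Z"
  have "(\<lambda>x. a \<otimes> x) ` Y = (\<lambda>x. a \<otimes> x) ` Z"
    using eq by (auto simp: mult_P set_mult_def)
  then show "Y = Z"
    using inj_on_image_eq_iff[OF inj_on_left_mult[OF a]] carrier_P YZ by blast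
qed

text \<open>
  Multiplying \<open>ab\<close> by \<open>x \<in> X\<close> gives \<open>b(xa)\<close>, where \<open>xa \<noteq> ab\<close> unless \<open>x = b\<close>; in that
  remaining case the product is \<open>a(bb)\<close>, and \<open>bb \<noteq> ab\<close>. So \<open>ab\<close> contributes nothing to \<open>X X\<^sup>2\<close>
  that the other members of \<open>X\<^sup>2\<close> do not already contribute.
\<close>

lemma set_mult_square_delete_product:
  assumes comm: "commutative S" and X: "X \<subseteq> carrier S"
    and ab: "a \<in> X" "b \<in> X" "a \<noteq> b"
  shows "X <#> ((X <#> X) - {a \<otimes> b}) = X <#> (X <#> X)"
proof
  show "X <#> ((X <#> X) - {a \<otimes> b}) \<subseteq> X <#> (X <#> X)"
    by (auto simp: set_mult_def)
  show "X <#> (X <#> X) \<subseteq> X <#> ((X <#> X) - {a \<otimes> b})"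
  proof
    fix u assume "u \<in> X <#> (X <#> X)"
    then obtain x v where x: "x \<in> X" and v: "v \<in> X <#> X" and u: "u = x \<otimes> v"
      by (auto simp: set_mult_def)
    have cS: "a \<in> carrier S" "b \<in> carrier S" "x \<in> carrier S"
      using X ab x by auto
    have c: "y \<otimes> z = z \<otimes> y" if "y \<in> carrier S" "z \<in> carrier S" for y z
      using comm that by (simp add: commutative_def)
    have cancel: "y = z" if "y \<otimes> w = z \<otimes> w" "y \<in> carrier S" "z \<in> carrier S" "w \<in> carrier S"
      for y z w
      using inj_onD[OF inj_on_right_mult[OF that(4)] that(1)] that by simp
    consider "v \<noteq> a \<otimes> b" | "v = a \<otimes> b" "x \<noteq> b" | "v = a \<otimes> b" "x = b" by blast
    then show "u \<in> X <#> ((X <#> X) - {a \<otimes> b})"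
    proof cases
      case 1
      then show ?thesis using x v u by (simp add: mult_in_set_mult)
    next
      case 2
      have "u = b \<otimes> (x \<otimes> a)"
        using u 2 cS c[of "x \<otimes> a" b] m_assoc[of x a b] by (simp add: m_closed)
      moreover have "x \<otimes> a \<noteq> a \<otimes> b"
        using 2 cS c[of a b] cancel[of x a b] by auto
      ultimately show ?thesis using x ab by (simp add: mult_in_set_mult)
    next
      case 3
      have "u = a \<otimes> (b \<otimes> b)"
        using u 3 cS c[of b "a \<otimes> b"] m_assoc[of a b b] by (simp add: m_closed)
      moreover have "b \<otimes> b \<noteq> a \<otimes> b"
        using ab cS cancel[of b b a] by auto
      ultimately show ?thesis using ab by (simp add: mult_in_set_mult)
    qed
  qed
qed

text \<open>
  Both \<open>X\<^sup>2\<close> and \<open>X\<^sup>2\<close> without \<open>ab\<close> lie in \<open>P\<close>, the latter by downward completeness, so the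
  preceding identity refutes cancellability of every \<open>X\<close> with two elements.
\<close>

lemma left_cancellable_iff_singleton:
  assumes comm: "commutative S" and X: "X \<in> carrier P"
  shows "left_cancellable P X \<longleftrightarrow> is_singleton X"
proof
  assume "is_singleton X"
  then obtain a where "X = {a}" by (auto simp: is_singleton_def)
  then show "left_cancellable P X"
    using carrier_P[OF X] singleton_left_cancellable by auto
next
  assume lc: "left_cancellable P X"
  have XS: "X \<subseteq> carrier S" "X \<noteq> {}" using carrier_P[OF X] by auto
  show "is_singleton X"
  proof (rule ccontr)
    assume "\<not> is_singleton X"
    then obtain a b where ab: "a \<in> X" "b \<in> X" "a \<noteq> b"
      using XS(2) unfolding is_singleton_def by blast
    have aab: "a \<otimes> a \<noteq> a \<otimes> b"
      using inj_onD[OF inj_on_left_mult, of a a b] ab XS by auto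
    have XX: "X <#> X \<in> carrier P"
      using P.m_closed[OF X X] by (simp add: mult_P)
    \<comment> \<open>The smaller set remains non-empty: it contains \<open>aa\<close>.\<close>
    have "a \<otimes> a \<in> (X <#> X) - {a \<otimes> b}"
      using aab ab by (simp add: mult_in_set_mult)
    then have "(X <#> X) - {a \<otimes> b} \<in> carrier P"
      using subset_P[OF XX, of "(X <#> X) - {a \<otimes> b}"] by blast
    then have "(X <#> X) - {a \<otimes> b} = X <#> X"
      using inj_onD[OF lc[unfolded left_cancellable_def]] XX
        set_mult_square_delete_product[OF comm XS(1) ab]
      by (simp add: mult_P)
    moreover have "a \<otimes> b \<in> X <#> X" using ab by (simp add: mult_in_set_mult)
    ultimately show False by blast
  qed
qed

end

lemma (in cancellative_semigroup) downward_complete_power_semigroup: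
  "downward_complete_power S (power_semigroup S)"
proof -
  interpret P: mult_semigroup "power_semigroup S" by (rule mult_semigroup_power_semigroup)
  show ?thesis by unfold_locales (auto simp: power_semigroup_def)
qed

lemma (in cancellative_semigroup) downward_complete_fin_power_semigroup:
  "downward_complete_power S (fin_power_semigroup S)"
proof -
  interpret P: mult_semigroup "fin_power_semigroup S" by (rule mult_semigroup_fin_power_semigroup)
  show ?thesis
    by unfold_locales (auto simp: fin_power_semigroup_def power_semigroup_def intro: finite_subset)
qed

section \<open>Transfer of isomorphisms\<close>

text \<open>
  Commutativity passes from one base semigroup to the other through \<open>P\<close> and \<open>Q\<close>, so on both sides
  the singletons are the cancellable elements. Hence an isomorphism from \<open>P\<close> to \<open>Q\<close> matches
  singletons with singletons and induces a map \<open>f\<close> with \<open>{x} \<mapsto> {f x}\<close>.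
\<close>

lemma is_iso_of_downward_complete_power_iso:
  fixes H :: "('a, 'm) monoid_scheme" and K :: "('b, 'n) monoid_scheme"
  assumes "downward_complete_power H P" "downward_complete_power K Q"
    and comm: "commutative H \<or> commutative K" and "P \<cong> Q"
  shows "H \<cong> K"
proof -
  interpret H: downward_complete_power H P by fact
  interpret K: downward_complete_power K Q by fact
  obtain h where h: "h \<in> iso P Q" using \<open>P \<cong> Q\<close> by (auto simp: is_iso_def)
  have hom: "h (X \<otimes>\<^bsub>P\<^esub> Y) = h X \<otimes>\<^bsub>Q\<^esub> h Y" if "X \<in> carrier P" "Y \<in> carrier P" for X Y
    using h that by (simp add: iso_def hom_def)
  have inj: "inj_on h (carrier P)" and surj: "h ` carrier P = carrier Q"
    using h by (auto simp: iso_def bij_betw_def)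
  have "commutative P \<longleftrightarrow> commutative Q"
    by (rule iso_commutative_iff[OF H.P.mult_semigroup_axioms h])
  then have comm': "commutative H" "commutative K"
    using comm H.commutative_P_iff K.commutative_P_iff by auto
  have sing: "is_singleton X \<longleftrightarrow> is_singleton (h X)" if X: "X \<in> carrier P" for X
  proof -
    have "h X \<in> carrier Q" using X surj by auto
    then show ?thesis
      using iso_left_cancellable_iff[OF H.P.mult_semigroup_axioms h X]
        H.left_cancellable_iff_singleton[OF comm'(1) X]
        K.left_cancellable_iff_singleton[OF comm'(2)] by simp
  qed
  define f where "f x = the_elem (h {x})" for x
  have f: "h {x} = {f x}" if "x \<in> carrier H" for x
    using sing[OF H.singleton_P[OF that]] is_singleton_the_elem[of "h {x}"]
    by (simp only: f_def is_singletonI)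
  have fK: "f x \<in> carrier K" if "x \<in> carrier H" for x
  proof -
    have "h {x} \<in> carrier Q" using surj H.singleton_P[OF that] by auto
    then have "{f x} \<in> carrier Q" by (simp add: f[OF that])
    then show ?thesis using K.carrier_P by blast
  qed
  have "f (x \<otimes>\<^bsub>H\<^esub> y) = f x \<otimes>\<^bsub>K\<^esub> f y" if xy: "x \<in> carrier H" "y \<in> carrier H" for x y
  proof -
    have "{f (x \<otimes>\<^bsub>H\<^esub> y)} = h ({x} \<otimes>\<^bsub>P\<^esub> {y})"
      using f[OF H.m_closed[OF xy]] by (simp add: H.mult_P set_mult_def)
    also have "\<dots> = {f x} \<otimes>\<^bsub>Q\<^esub> {f y}"
      using hom H.singleton_P xy f by simp
    finally show ?thesis by (simp add: K.mult_P set_mult_def)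
  qed
  then have "f \<in> hom H K" using fK by (auto simp: hom_def)
  moreover have "inj_on f (carrier H)"
  proof (rule inj_onI)
    fix x y assume "x \<in> carrier H" "y \<in> carrier H" "f x = f y"
    then have "{x} = {y}"
      using inj_onD[OF inj, of "{x}" "{y}"] f H.singleton_P by simp
    then show "x = y" by simp
  qed
  moreover have "f ` carrier H = carrier K"
  proof
    show "f ` carrier H \<subseteq> carrier K" using fK by auto
    show "carrier K \<subseteq> f ` carrier H"
    proof
      fix y assume "y \<in> carrier K"
      then have "{y} \<in> h ` carrier P" using K.singleton_P surj by simp
      then obtain X where X: "X \<in> carrier P" "h X = {y}" by auto
      then have "is_singleton X" using sing by (simp add: is_singleton_def)
      then obtain x where "X = {x}" by (auto simp: is_singleton_def)
      then show "y \<in> f ` carrier H"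
        using X f[of x] H.carrier_P[OF X(1)] by auto
    qed
  qed
  ultimately show ?thesis by (auto simp: is_iso_def iso_def bij_betw_def)
qed

text \<open>
  Direct image along \<open>f\<close> is the isomorphism. The last hypothesis asks \<open>P\<close> and \<open>Q\<close> to select
  corresponding families of subsets; isomorphism of the base semigroups alone does not ensure
  this, as one family may be large and the other finitary.
\<close>

lemma is_iso_power_of_is_iso:
  fixes H :: "('a, 'm) monoid_scheme" and K :: "('b, 'n) monoid_scheme"
  assumes "downward_complete_power H P" "downward_complete_power K Q" and f: "f \<in> iso H K"
    and PQ: "\<And>X. X \<subseteq> carrier H \<Longrightarrow> X \<in> carrier P \<longleftrightarrow> f ` X \<in> carrier Q"
  shows "P \<cong> Q"
proof -
  interpret H: downward_complete_power H P by fact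
  interpret K: downward_complete_power K Q by fact
  have hom: "f (x \<otimes>\<^bsub>H\<^esub> y) = f x \<otimes>\<^bsub>K\<^esub> f y" if "x \<in> carrier H" "y \<in> carrier H" for x y
    using f that by (simp add: iso_def hom_def)
  have inj: "inj_on f (carrier H)" and surj: "f ` carrier H = carrier K"
    using f by (auto simp: iso_def bij_betw_def)
  have "f ` (X \<otimes>\<^bsub>P\<^esub> Y) = f ` X \<otimes>\<^bsub>Q\<^esub> f ` Y" if "X \<in> carrier P" "Y \<in> carrier P" for X Y
  proof -
    have "X \<subseteq> carrier H" "Y \<subseteq> carrier H" using H.carrier_P that by auto
    then have "(\<Union>x\<in>X. \<Union>y\<in>Y. {f (x \<otimes>\<^bsub>H\<^esub> y)}) = (\<Union>x\<in>X. \<Union>y\<in>Y. {f x \<otimes>\<^bsub>K\<^esub> f y})"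
      by (intro SUP_cong refl) (simp add: hom subset_iff)
    then show ?thesis by (simp add: H.mult_P K.mult_P set_mult_def image_UN)
  qed
  moreover have "f ` X \<in> carrier Q" if "X \<in> carrier P" for X
    using PQ H.carrier_P that by blast
  ultimately have "image f \<in> hom P Q" by (simp add: hom_def)
  moreover have "inj_on (image f) (carrier P)"
  proof (rule inj_onI)
    fix X Y assume "X \<in> carrier P" "Y \<in> carrier P" "f ` X = f ` Y"
    then show "X = Y" using inj_on_image_eq_iff[OF inj, of X Y] H.carrier_P by simp
  qed
  moreover have "image f ` carrier P = carrier Q"
  proof
    show "image f ` carrier P \<subseteq> carrier Q" using PQ H.carrier_P by blast
    show "carrier Q \<subseteq> image f ` carrier P"
    proof
      fix Y assume Y: "Y \<in> carrier Q"
      then have "Y \<subseteq> f ` carrier H" using K.carrier_P surj by blast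
      then obtain X where "X \<subseteq> carrier H" "Y = f ` X" by (auto simp: subset_image_iff)
      then show "Y \<in> image f ` carrier P" using PQ Y by blast
    qed
  qed
  ultimately show ?thesis by (auto simp: is_iso_def iso_def bij_betw_def)
qed

theorem corollary1:
  fixes H :: "('a, 'm) monoid_scheme" and K :: "('b, 'n) monoid_scheme"
  assumes "cancellative_semigroup H" and "cancellative_semigroup K"
    and "commutative H \<or> commutative K"
  shows "(power_semigroup H \<cong> power_semigroup K \<longleftrightarrow>
            fin_power_semigroup H \<cong> fin_power_semigroup K) \<and>
         (fin_power_semigroup H \<cong> fin_power_semigroup K \<longleftrightarrow> H \<cong> K)"
proof -
  note large = assms(1,2)[THEN cancellative_semigroup.downward_complete_power_semigroup]
  note fin = assms(1,2)[THEN cancellative_semigroup.downward_complete_fin_power_semigroup]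
  have lift: "power_semigroup H \<cong> power_semigroup K \<and> fin_power_semigroup H \<cong> fin_power_semigroup K"
    if "H \<cong> K"
  proof -
    obtain f where f: "f \<in> iso H K" using \<open>H \<cong> K\<close> by (auto simp: is_iso_def)
    then have inj: "inj_on f (carrier H)" and surj: "f ` carrier H = carrier K"
      by (auto simp: iso_def bij_betw_def)
    have large_iff: "X \<in> carrier (power_semigroup H) \<longleftrightarrow> f ` X \<in> carrier (power_semigroup K)"
      if "X \<subseteq> carrier H" for X
      using that surj by (auto simp: power_semigroup_def)
    moreover have "X \<in> carrier (fin_power_semigroup H) \<longleftrightarrow> f ` X \<in> carrier (fin_power_semigroup K)"
      if "X \<subseteq> carrier H" for X
      using large_iff[OF that] finite_image_iff[OF inj_on_subset[OF inj that]]
      by (simp add: fin_power_semigroup_def)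
    ultimately show ?thesis
      using is_iso_power_of_is_iso[OF large f] is_iso_power_of_is_iso[OF fin f] by blast
  qed
  show ?thesis
    using lift is_iso_of_downward_complete_power_iso[OF large assms(3)]
      is_iso_of_downward_complete_power_iso[OF fin assms(3)] by blast
qed

end
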